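(* Let $G$ be an $s$-regular graph with $s\ge 1$, $q$ vertices and $m$ edges. (1) If $q$ is even, every one-factorization of $G$ defines a uniformly colored graph of type $(s,q,q/2)$, and $m=sq/2$. (2) If $q$ is odd, every near-one-factorization of $G$ defines a uniformly colored graph of type $\left(\frac{sq}{q-1},\,q,\,\frac{q-1}{2}\right)$, and $m=sq/2$. Here the coloring defined by a one-factorization or near-one-factorization with parts $H_1,\dots,H_p$ assigns to each edge of $G$ the color $k$ for which the edge lies in $H_k$.
   Context: Graphs are finite, without loops or multiple edges. A one-factor of $G=(V,E)$ is a subgraph with vertex set $V$ that is regular of degree one; a one-factorization of $G$ is a set of pairwise edge-disjoint one-factors whose union is $G$. A near-one-factor is a set of pairwise non-adjacent edges covering all vertices but one; a near-one-factorization is a decomposition of $G$ (partition of its edges) into near-one-factors. A uniform edge coloring of type $(p,q,r)$ ($p,q,r$ positive integers) with degree $s\ge 1$ on an undirected $s$-regular graph $(V,E)$ with $q$ vertices is a surjective map $c:E\to S$, $|S|=p$, such that adjacent edges have different colors (the coloring is proper) and $|c^{-1}(\{k\})|=r$ for every $k\in S$. A graph with such a coloring is a uniformly colored graph of type $(p,q,r)$. *)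

theory Defs
  imports Complex_Main "HOL-Library.Disjoint_Sets"
begin

text \<open>
  A graph is given by its vertex set \<open>V\<close> and its edge set \<open>E\<close>, an edge being the two-element set
  of its ends. The vertex set is required to be nonempty: the parameters \<open>(p, q, r)\<close> of a uniform
  edge coloring are positive, so the empty graph never has a type.
\<close>

definition simple_graph :: "'a set \<Rightarrow> 'a set set \<Rightarrow> bool" where
  "simple_graph V E \<longleftrightarrow> finite V \<and> V \<noteq> {} \<and> (\<forall>e\<in>E. e \<subseteq> V \<and> card e = 2)"

definition degree :: "'a set set \<Rightarrow> 'a \<Rightarrow> nat" where
  "degree E v = card {e \<in> E. v \<in> e}"

definition regular :: "'a set \<Rightarrow> 'a set set \<Rightarrow> nat \<Rightarrow> bool" where
  "regular V E s \<longleftrightarrow> (\<forall>v\<in>V. degree E v = s)"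

definition adjacent_edges :: "'a set \<Rightarrow> 'a set \<Rightarrow> bool" where
  "adjacent_edges e f \<longleftrightarrow> e \<noteq> f \<and> e \<inter> f \<noteq> {}"

text \<open>
  A one-factor is a spanning subgraph, so it is identified with its edge set \<open>F\<close>; likewise a
  one-factorization is a set of edge sets.
\<close>

definition one_factor :: "'a set \<Rightarrow> 'a set set \<Rightarrow> 'a set set \<Rightarrow> bool" where
  "one_factor V E F \<longleftrightarrow> F \<subseteq> E \<and> regular V F 1"

definition one_factorization :: "'a set \<Rightarrow> 'a set set \<Rightarrow> 'a set set set \<Rightarrow> bool" where
  "one_factorization V E \<F> \<longleftrightarrow> (\<forall>F\<in>\<F>. one_factor V E F) \<and> disjoint \<F> \<and> \<Union>\<F> = E"

definition near_one_factor :: "'a set \<Rightarrow> 'a set set \<Rightarrow> 'a set set \<Rightarrow> bool" where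
  "near_one_factor V E F \<longleftrightarrow>
     F \<subseteq> E \<and> (\<forall>e\<in>F. \<forall>f\<in>F. \<not> adjacent_edges e f) \<and> (\<exists>v\<in>V. \<Union>F = V - {v})"

definition near_one_factorization :: "'a set \<Rightarrow> 'a set set \<Rightarrow> 'a set set set \<Rightarrow> bool" where
  "near_one_factorization V E \<F> \<longleftrightarrow> (\<forall>F\<in>\<F>. near_one_factor V E F) \<and> partition_on E \<F>"

text \<open>
  \<open>c\<close> is a uniform edge coloring of type \<open>(p, q, r)\<close> with degree \<open>s\<close> and color set \<open>S\<close> on the graph
  \<open>(V, E)\<close>; equivalently, \<open>(V, E)\<close> together with \<open>c\<close> is a uniformly colored graph of type \<open>(p, q, r)\<close>.
  Only the values of \<open>c\<close> on \<open>E\<close> matter.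
\<close>

definition uniform_edge_coloring ::
    "'a set \<Rightarrow> 'a set set \<Rightarrow> ('a set \<Rightarrow> 'c) \<Rightarrow> 'c set \<Rightarrow> nat \<Rightarrow> nat \<times> nat \<times> nat \<Rightarrow> bool" where
  "uniform_edge_coloring V E c S s = (\<lambda>(p, q, r).
     p \<ge> 1 \<and> q \<ge> 1 \<and> r \<ge> 1 \<and> s \<ge> 1 \<and>
     simple_graph V E \<and> regular V E s \<and> card V = q \<and>
     card S = p \<and> c ` E = S \<and>
     (\<forall>e\<in>E. \<forall>f\<in>E. adjacent_edges e f \<longrightarrow> c e \<noteq> c f) \<and>
     (\<forall>k\<in>S. card {e \<in> E. c e = k} = r))"

definition parts_coloring :: "nat \<Rightarrow> (nat \<Rightarrow> 'a set set) \<Rightarrow> 'a set \<Rightarrow> nat" where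
  "parts_coloring p H e = (THE k. k \<in> {1..p} \<and> e \<in> H k)"

end

theory Submission
  imports Defs
begin

text \<open>The parts of either kind of factorization are matchings of one common size
  \<open>r\<close>: half of the vertices for one-factors, half of all vertices but one for
  near-one-factors. The color classes of \<open>parts_coloring\<close> are exactly these parts, so
  the coloring is proper because parts are matchings, and uniform because they have equal size
  (\<open>uniform_edge_coloring_parts_coloring\<close>). The number \<open>p\<close> of colors is
  then forced by counting edges twice: the classes give \<open>card E = p * r\<close>, and the
  degree sum (\<open>handshake\<close>) gives \<open>2 * card E = s * card V\<close>. With
  \<open>2 * r = card V\<close> this yields \<open>p = s\<close>; with
  \<open>2 * r = card V - 1\<close> it yields \<open>p * (card V - 1) = s * card V\<close>.\<close>

lemma simple_graph_finite_edges:
  assumes "simple_graph V E"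
  shows "finite E"
proof -
  have "E \<subseteq> Pow V" "finite V"
    using assms by (auto simp: simple_graph_def)
  then show ?thesis
    by (meson finite_Pow_iff finite_subset)
qed

lemma simple_graph_subset:
  assumes "simple_graph V E" "F \<subseteq> E"
  shows "simple_graph V F"
  using assms by (auto simp: simple_graph_def)

text \<open>Double counting of the incident pairs of a vertex and an edge: every edge has two ends,
  both in \<open>V\<close>.\<close>

lemma handshake:
  assumes "simple_graph V E"
  shows "(\<Sum>v\<in>V. degree E v) = 2 * card E"
proof -
  have V: "finite V" and E: "\<And>e. e \<in> E \<Longrightarrow> e \<subseteq> V \<and> card e = 2"
    using assms by (auto simp: simple_graph_def)
  have "(\<Sum>v\<in>V. degree E v) = (\<Sum>v\<in>V. \<Sum>e\<in>{e \<in> E. v \<in> e}. 1)"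
    by (simp add: degree_def)
  also have "\<dots> = (\<Sum>e\<in>E. \<Sum>v\<in>{v \<in> V. v \<in> e}. 1)"
    using V simple_graph_finite_edges[OF assms] by (rule sum.swap_restrict)
  also have "\<dots> = (\<Sum>e\<in>E. 2)"
  proof (rule sum.cong[OF refl])
    fix e assume "e \<in> E"
    moreover from this have "{v \<in> V. v \<in> e} = e" using E by blast
    ultimately show "(\<Sum>v\<in>{v \<in> V. v \<in> e}. 1) = (2::nat)" using E by simp
  qed
  finally show ?thesis by simp
qed

lemma regular_card_edges:
  assumes "simple_graph V E" "regular V E s"
  shows "2 * card E = s * card V"
  using handshake[OF assms(1)] assms(2) by (simp add: regular_def mult.commute)

text \<open>The degree sum is applied to \<open>F\<close> itself, as a 1-regular graph on all of
  \<open>V\<close>.\<close>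

lemma one_factor_card:
  assumes "simple_graph V E" "one_factor V E F"
  shows "2 * card F = card V"
  using regular_card_edges[of V F 1] simple_graph_subset assms
  by (auto simp: one_factor_def)

text \<open>A common vertex of two edges has degree one in \<open>F\<close>, which makes the edges
  equal.\<close>

lemma one_factor_not_adjacent:
  assumes "simple_graph V E" "one_factor V E F" "e \<in> F" "f \<in> F"
  shows "\<not> adjacent_edges e f"
proof
  assume adj: "adjacent_edges e f"
  then obtain v where v: "v \<in> e" "v \<in> f"
    by (auto simp: adjacent_edges_def)
  then have "v \<in> V"
    using assms by (auto simp: simple_graph_def one_factor_def)
  then have "card {e \<in> F. v \<in> e} = 1"
    using assms(2) by (simp add: one_factor_def regular_def degree_def)
  then obtain g where g: "{e \<in> F. v \<in> e} = {g}"
    by (rule card_1_singletonE)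
  have "e \<in> {e \<in> F. v \<in> e}" "f \<in> {e \<in> F. v \<in> e}"
    using v assms(3,4) by auto
  then have "e = f"
    unfolding g by simp
  with adj show False by (simp add: adjacent_edges_def)
qed

text \<open>The edges of \<open>F\<close> are disjoint pairs, and together they fill
  \<open>V\<close> except for one vertex.\<close>

lemma near_one_factor_card:
  assumes "simple_graph V E" "near_one_factor V E F"
  shows "2 * card F = card V - 1"
proof -
  obtain v where v: "v \<in> V" "\<Union>F = V - {v}"
    using assms(2) by (auto simp: near_one_factor_def)
  have F: "e \<subseteq> V" "card e = 2" if "e \<in> F" for e
    using assms that by (auto simp: near_one_factor_def simple_graph_def)
  have "pairwise disjnt F"
    using assms(2)
    by (auto simp: near_one_factor_def adjacent_edges_def pairwise_def disjnt_def)
  then have "card (\<Union>F) = (\<Sum>e\<in>F. card e)"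
    using F by (intro card_Union_disjoint) (auto intro: card_ge_0_finite)
  also have "\<dots> = 2 * card F"
    using F by simp
  finally show ?thesis
    using v by simp
qed

text \<open>Shows that the definite description is well defined: disjointness identifies the part
  containing \<open>e\<close>, and injectivity of \<open>H\<close> identifies its index.\<close>

lemma parts_coloring_eq:
  assumes "disjoint \<F>" "bij_betw H {1..p} \<F>" "k \<in> {1..p}" "e \<in> H k"
  shows "parts_coloring p H e = k"
  unfolding parts_coloring_def
proof (rule the_equality)
  fix j assume j: "j \<in> {1..p} \<and> e \<in> H j"
  moreover have "H j \<in> \<F>" "H k \<in> \<F>"
    using assms(2,3) j by (auto intro: bij_betw_apply)
  ultimately have "H j = H k"
    using assms(4) disjointD[OF assms(1), of "H j" "H k"] by blast
  then show "j = k"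
    using bij_betw_imp_inj_on[OF assms(2)] assms(3) j by (meson inj_onD)
qed (use assms in auto)

lemma parts_coloring_class:
  assumes "disjoint \<F>" "\<Union>\<F> = E" "bij_betw H {1..p} \<F>" "k \<in> {1..p}"
  shows "{e \<in> E. parts_coloring p H e = k} = H k"
proof -
  have "\<exists>j\<in>{1..p}. e \<in> H j" if "e \<in> E" for e
    using that assms(2,3) by (auto simp: bij_betw_def)
  moreover have "H k \<subseteq> E"
    using assms(2) bij_betw_apply[OF assms(3,4)] by blast
  ultimately show ?thesis
    using parts_coloring_eq[OF assms(1,3)] assms(4) by blast
qed

text \<open>The common core of both cases: all that matters is that the parts partition
  \<open>E\<close> into matchings of equal positive size. The second conclusion is what later
  determines \<open>p\<close>.\<close>

lemma uniform_edge_coloring_parts_coloring: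
  assumes G: "simple_graph V E" "regular V E s" "s \<ge> 1"
    and \<F>: "disjoint \<F>" "\<Union>\<F> = E" and H: "bij_betw H {1..p} \<F>"
    and matching: "\<And>F e f. F \<in> \<F> \<Longrightarrow> e \<in> F \<Longrightarrow> f \<in> F \<Longrightarrow> \<not> adjacent_edges e f"
    and card: "\<And>F. F \<in> \<F> \<Longrightarrow> card F = r" and "r \<ge> 1"
  shows "uniform_edge_coloring V E (parts_coloring p H) {1..p} s (p, card V, r)"
    and "card E = p * r"
proof -
  let ?c = "parts_coloring p H"
  note cls = parts_coloring_class[OF \<F> H]
  have fin: "finite E" by (rule simple_graph_finite_edges[OF G(1)])
  have H\<F>: "H k \<in> \<F>" if "k \<in> {1..p}" for k
    using H that by (rule bij_betw_apply)
  \<comment> \<open>A vertex exists, and its degree \<open>s\<close> is positive.\<close>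
  have "E \<noteq> {}" "card V \<ge> 1"
    using G by (auto simp: simple_graph_def regular_def degree_def Suc_le_eq card_gt_0_iff)
  have ran: "?c e \<in> {1..p}" if e: "e \<in> E" for e
  proof -
    obtain k where "k \<in> {1..p}" "e \<in> H k"
      using e \<F>(2) H by (auto simp: bij_betw_def)
    then show ?thesis
      using parts_coloring_eq[OF \<F>(1) H] by metis
  qed
  have class_card: "card {e \<in> E. ?c e = k} = r" if "k \<in> {1..p}" for k
    using cls[OF that] card[OF H\<F>[OF that]] by simp
  have img: "?c ` E = {1..p}"
  proof (intro equalityI subsetI)
    \<comment> \<open>Surjectivity: since \<open>r\<close> is positive, no color class is
      empty.\<close>
    fix k assume "k \<in> {1..p}"
    then have "{e \<in> E. ?c e = k} \<noteq> {}"
      using class_card \<open>r \<ge> 1\<close> by fastforce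
    then show "k \<in> ?c ` E" by blast
  qed (use ran in blast)
  then have "p \<ge> 1"
    using \<open>E \<noteq> {}\<close> by (cases p) auto
  moreover have "?c e \<noteq> ?c f" if "e \<in> E" "f \<in> E" "adjacent_edges e f" for e f
  proof
    assume "?c e = ?c f"
    with that(1,2) have "e \<in> {g \<in> E. ?c g = ?c e}" "f \<in> {g \<in> E. ?c g = ?c e}"
      by simp_all
    then have "e \<in> H (?c e)" "f \<in> H (?c e)"
      unfolding cls[OF ran[OF that(1)]] .
    then show False
      using matching[OF H\<F>[OF ran[OF that(1)]]] that(3) by blast
  qed
  ultimately show "uniform_edge_coloring V E ?c {1..p} s (p, card V, r)"
    unfolding uniform_edge_coloring_def using G img class_card \<open>card V \<ge> 1\<close> \<open>r \<ge> 1\<close> by simp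
  \<comment> \<open>The edges are counted by color, as a sum of ones grouped along
    \<open>?c\<close>.\<close>
  have "card E = (\<Sum>k\<in>{1..p}. card {e \<in> E. ?c e = k})"
    using sum.group[of E "{1..p}" ?c "\<lambda>_. 1::nat"] fin img by simp
  also have "\<dots> = p * r"
    using class_card by simp
  finally show "card E = p * r" .
qed

lemma one_factorization_coloring:
  assumes G: "simple_graph V E" "regular V E s" "s \<ge> 1"
    and \<F>: "one_factorization V E \<F>" and H: "bij_betw H {1..p} \<F>"
  shows "uniform_edge_coloring V E (parts_coloring p H) {1..p} s (s, card V, card V div 2)"
proof -
  let ?r = "card V div 2"
  have F: "one_factor V E F" if "F \<in> \<F>" for F
    using \<F> that by (simp add: one_factorization_def)
  have dis: "disjoint \<F>" "\<Union>\<F> = E"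
    using \<F> by (auto simp: one_factorization_def)
  have V: "card V \<ge> 1" and "E \<noteq> {}"
    using G by (auto simp: simple_graph_def regular_def degree_def Suc_le_eq card_gt_0_iff)
  then obtain F where "F \<in> \<F>"
    using dis by blast
  \<comment> \<open>The existence of a single one-factor makes \<open>card V\<close> even, so
    halving is exact.\<close>
  then have even: "2 * ?r = card V"
    using one_factor_card[OF G(1) F[OF \<open>F \<in> \<F>\<close>]] by presburger
  with V have r: "?r \<ge> 1" by linarith
  have crd: "card F = ?r" if "F \<in> \<F>" for F
    using one_factor_card[OF G(1) F[OF that]] by simp
  note col = uniform_edge_coloring_parts_coloring[OF G dis H
      one_factor_not_adjacent[OF G(1) F] crd r]
  \<comment> \<open>Both sides are \<open>2 * card E\<close>; cancelling the positive
    \<open>2 * ?r\<close> leaves \<open>p = s\<close>.\<close>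
  have "2 * (p * ?r) = s * (2 * ?r)"
    using regular_card_edges[OF G(1,2)] col(2) even by simp
  with r have "p = s" by simp
  with col(1) show ?thesis by simp
qed

text \<open>The divisibility claim ensures that the natural-number quotient in the type is the true
  fraction.\<close>

lemma near_one_factorization_coloring:
  assumes G: "simple_graph V E" "regular V E s" "s \<ge> 1"
    and \<F>: "near_one_factorization V E \<F>" and H: "bij_betw H {1..p} \<F>"
  shows "(card V - 1) dvd s * card V"
    and "uniform_edge_coloring V E (parts_coloring p H) {1..p} s
           (s * card V div (card V - 1), card V, (card V - 1) div 2)"
proof -
  let ?r = "(card V - 1) div 2"
  have F: "near_one_factor V E F" if "F \<in> \<F>" for F
    using \<F> that by (simp add: near_one_factorization_def)
  have dis: "disjoint \<F>" "\<Union>\<F> = E" "{} \<notin> \<F>"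
    using \<F> by (auto simp: near_one_factorization_def partition_on_def)
  have "E \<noteq> {}"
    using G by (auto simp: simple_graph_def regular_def degree_def)
  then obtain F where "F \<in> \<F>"
    using dis by blast
  then have odd: "2 * ?r = card V - 1"
    using near_one_factor_card[OF G(1) F[OF \<open>F \<in> \<F>\<close>]] by presburger
  have crd: "card F = ?r" if "F \<in> \<F>" for F
    using near_one_factor_card[OF G(1) F[OF that]] by simp
  \<comment> \<open>A part of a partition is nonempty; this gives \<open>?r\<close> at least 1 and
    hence the nonzero divisor \<open>card V - 1\<close> below.\<close>
  have "F \<subseteq> E" "F \<noteq> {}"
    using \<open>F \<in> \<F>\<close> dis by blast+
  then have "card F > 0"
    using simple_graph_finite_edges[OF G(1)] by (simp add: card_gt_0_iff finite_subset)
  then have r: "?r \<ge> 1"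
    unfolding crd[OF \<open>F \<in> \<F>\<close>] by simp
  have "\<not> adjacent_edges e f" if "F \<in> \<F>" "e \<in> F" "f \<in> F" for F e f
    using F[OF that(1)] that by (simp add: near_one_factor_def)
  note col = uniform_edge_coloring_parts_coloring[OF G dis(1,2) H this crd r]
  have "s * card V = p * (2 * ?r)"
    using regular_card_edges[OF G(1,2)] col(2) by simp
  \<comment> \<open>Exhibits \<open>p\<close> as the exact quotient, from which both conclusions
    follow.\<close>
  then have eq: "s * card V = p * (card V - 1)"
    by (simp only: odd)
  then show "(card V - 1) dvd s * card V" by simp
  have "card V - 1 \<noteq> 0"
    using r by auto
  then have "s * card V div (card V - 1) = p"
    unfolding eq by (rule nonzero_mult_div_cancel_right)
  with col(1) show "uniform_edge_coloring V E (parts_coloring p H) {1..p} s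
           (s * card V div (card V - 1), card V, (card V - 1) div 2)"
    by simp
qed

theorem proposition5p6:
  fixes V :: "'a set" and E :: "'a set set" and s q m :: nat
  assumes "simple_graph V E"
    and "regular V E s" and "s \<ge> 1"
    and "card V = q" and "card E = m"
  shows "(even q \<longrightarrow>
            (\<forall>\<F> p H. one_factorization V E \<F> \<and> bij_betw H {1..p} \<F> \<longrightarrow>
               uniform_edge_coloring V E (parts_coloring p H) {1..p} s (s, q, q div 2))
            \<and> real m = real s * real q / 2)
       \<and> (odd q \<longrightarrow>
            (\<forall>\<F> p H. near_one_factorization V E \<F> \<and> bij_betw H {1..p} \<F> \<longrightarrow>
               (q - 1) dvd s * q \<and>
               uniform_edge_coloring V E (parts_coloring p H) {1..p} s
                 (s * q div (q - 1), q, (q - 1) div 2))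
            \<and> real m = real s * real q / 2)"
proof -
  have "2 * m = s * q"
    using regular_card_edges[OF assms(1,2)] assms(4,5) by simp
  then have "real m = real s * real q / 2"
    by (metis nonzero_mult_div_cancel_left of_nat_mult of_nat_numeral zero_neq_numeral)
  then show ?thesis
    using one_factorization_coloring[OF assms(1-3)] near_one_factorization_coloring[OF assms(1-3)]
    unfolding assms(4) by blast
qed

end
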